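(* Let $n\ge 5$ and let $G$ be a connected (finite simple) graph with $n$ vertices. Then $\frac{\alpha'_f(G)}{\alpha'(G)}\le \frac{3n}{2n+2}$, and equality holds only when either (i) $n=5$ and either $C_5$ is a subgraph of $G$ or $K_2+K_3$ is a subgraph of $G$, or (ii) $G$ has a vertex $v$ such that the components of $G-v$ are all copies of $K_3$ except for one component which is a single vertex.
   Context: $\alpha'(G)$ is the maximum size of a matching (set of pairwise disjoint edges) in $G$. A fractional matching of $G$ is a function $\phi:E(G)\to[0,1]$ with $\sum_{e\ni v}\phi(e)\le 1$ for every vertex $v$; its size is $\sum_{e\in E(G)}\phi(e)$, and $\alpha'_f(G)$ is the maximum size of a fractional matching of $G$. $K_2+K_3$ denotes the disjoint union of $K_2$ and $K_3$. *)

theory Defs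
  imports "HOL-Analysis.Analysis"
begin

type_synonym 'a graph = "'a set \<times> 'a set set"

abbreviation verts :: "'a graph \<Rightarrow> 'a set" where "verts G \<equiv> fst G"
abbreviation edges :: "'a graph \<Rightarrow> 'a set set" where "edges G \<equiv> snd G"

definition finite_simple_graph :: "'a graph \<Rightarrow> bool" where
  "finite_simple_graph G \<longleftrightarrow>
     finite (verts G) \<and> (\<forall>e\<in>edges G. e \<subseteq> verts G \<and> card e = 2)"

definition subgraph :: "'a graph \<Rightarrow> 'a graph \<Rightarrow> bool" where
  "subgraph H G \<longleftrightarrow> verts H \<subseteq> verts G \<and> edges H \<subseteq> edges G"

definition induced_subgraph :: "'a graph \<Rightarrow> 'a set \<Rightarrow> 'a graph" where
  "induced_subgraph G S = (verts G \<inter> S, {e \<in> edges G. e \<subseteq> S})"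

definition delete_vertex :: "'a graph \<Rightarrow> 'a \<Rightarrow> 'a graph" where
  "delete_vertex G v = (verts G - {v}, {e \<in> edges G. v \<notin> e})"

definition graph_iso :: "'a graph \<Rightarrow> 'b graph \<Rightarrow> bool" where
  "graph_iso G H \<longleftrightarrow>
     (\<exists>f. bij_betw f (verts G) (verts H) \<and> edges H = (\<lambda>e. f ` e) ` edges G)"

text \<open>As usual, ``\<open>H\<close> is a subgraph of \<open>G\<close>'' for a fixed graph \<open>H\<close> such as \<open>C\<^sub>5\<close> means
  that some (not necessarily induced) subgraph of \<open>G\<close> is isomorphic to \<open>H\<close>.\<close>

definition contains_copy :: "'a graph \<Rightarrow> 'b graph \<Rightarrow> bool" where
  "contains_copy G H \<longleftrightarrow> (\<exists>H'. subgraph H' G \<and> graph_iso H H')"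

definition reachable :: "'a graph \<Rightarrow> 'a \<Rightarrow> 'a \<Rightarrow> bool" where
  "reachable G u v \<longleftrightarrow>
     u \<in> verts G \<and> v \<in> verts G \<and> (u, v) \<in> {(x, y). {x, y} \<in> edges G}\<^sup>*"

definition graph_connected :: "'a graph \<Rightarrow> bool" where
  "graph_connected G \<longleftrightarrow> verts G \<noteq> {} \<and> (\<forall>u\<in>verts G. \<forall>v\<in>verts G. reachable G u v)"

definition graph_components :: "'a graph \<Rightarrow> 'a graph set" where
  "graph_components G = (\<lambda>u. induced_subgraph G {v. reachable G u v}) ` verts G"

definition complete_graph :: "nat \<Rightarrow> nat graph" where
  "complete_graph n = ({..<n}, {e. e \<subseteq> {..<n} \<and> card e = 2})"

text \<open>Only meaningful for \<open>n \<ge> 3\<close>.\<close>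

definition cycle_graph :: "nat \<Rightarrow> nat graph" where
  "cycle_graph n = ({..<n}, (\<lambda>i. {i, (i + 1) mod n}) ` {..<n})"

definition disjoint_union :: "'a graph \<Rightarrow> 'b graph \<Rightarrow> ('a + 'b) graph" where
  "disjoint_union G H =
     (verts G <+> verts H, (\<lambda>e. Inl ` e) ` edges G \<union> (\<lambda>e. Inr ` e) ` edges H)"

definition matching :: "'a graph \<Rightarrow> 'a set set \<Rightarrow> bool" where
  "matching G M \<longleftrightarrow> M \<subseteq> edges G \<and> pairwise disjnt M"

definition matching_number :: "'a graph \<Rightarrow> nat" where
  "matching_number G = Max (card ` {M. matching G M})"

text \<open>Only the values of \<open>\<phi>\<close> on the edges of \<open>G\<close> matter.\<close>

definition fractional_matching :: "'a graph \<Rightarrow> ('a set \<Rightarrow> real) \<Rightarrow> bool" where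
  "fractional_matching G \<phi> \<longleftrightarrow>
     (\<forall>e\<in>edges G. 0 \<le> \<phi> e \<and> \<phi> e \<le> 1) \<and>
     (\<forall>v\<in>verts G. (\<Sum>e | e \<in> edges G \<and> v \<in> e. \<phi> e) \<le> 1)"

definition fractional_size :: "'a graph \<Rightarrow> ('a set \<Rightarrow> real) \<Rightarrow> real" where
  "fractional_size G \<phi> = (\<Sum>e\<in>edges G. \<phi> e)"

definition fractional_matching_number :: "'a graph \<Rightarrow> real" where
  "fractional_matching_number G = Sup (fractional_size G ` {\<phi>. fractional_matching G \<phi>})"

text \<open>For a finite graph this supremum is a maximum:\<close>

lemma finite_edges:
  assumes "finite_simple_graph G"
  shows "finite (edges G)"
proof (rule finite_subset)
  show "edges G \<subseteq> Pow (verts G)" "finite (Pow (verts G))"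
    using assms by (auto simp: finite_simple_graph_def)
qed

lemma fractional_matching_number_is_max:
  assumes "finite_simple_graph G"
  shows "\<exists>\<phi>. fractional_matching G \<phi> \<and> fractional_size G \<phi> = fractional_matching_number G"
    and "\<And>\<psi>. fractional_matching G \<psi> \<Longrightarrow> fractional_size G \<psi> \<le> fractional_matching_number G"
proof -
  define B where "B = PiE UNIV (\<lambda>e. if e \<in> edges G then {0..1::real} else {0})"
  define K where "K = B \<inter> (\<Inter>v\<in>verts G. {\<phi>. (\<Sum>e | e \<in> edges G \<and> v \<in> e. \<phi> e) \<le> 1})"
  have "compactin (product_topology (\<lambda>_. euclidean) UNIV) B"
    unfolding B_def compactin_PiE by (auto simp: compactin_euclidean_iff)
  then have "compact B"
    by (simp add: euclidean_product_topology compactin_euclidean_iff)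
  moreover have "closed (\<Inter>v\<in>verts G. {\<phi>::'a set \<Rightarrow> real. (\<Sum>e | e \<in> edges G \<and> v \<in> e. \<phi> e) \<le> 1})"
    by (intro closed_INT ballI closed_Collect_le continuous_on_sum continuous_on_const
        continuous_on_product_coordinates)
  ultimately have "compact K"
    unfolding K_def by (rule compact_Int_closed)
  moreover have "continuous_on K (fractional_size G)"
    unfolding fractional_size_def
    by (intro continuous_on_sum continuous_on_subset[OF continuous_on_product_coordinates]) auto
  moreover have "(\<lambda>_. 0) \<in> K"
    by (auto simp: K_def B_def)
  then have "K \<noteq> {}"
    by blast
  ultimately obtain \<phi> where \<phi>: "\<phi> \<in> K"
    "\<forall>\<psi>\<in>K. fractional_size G \<psi> \<le> fractional_size G \<phi>"
    using continuous_attains_sup[of K "fractional_size G"] by blast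
  have "\<phi> e \<in> {0..1}" if "e \<in> edges G" for e
  proof -
    have "\<phi> e \<in> (if e \<in> edges G then {0..1} else {0})"
      using \<phi>(1) unfolding K_def B_def by (rule PiE_mem[OF IntD1]) (rule UNIV_I)
    with that show ?thesis
      by simp
  qed
  then have fm: "fractional_matching G \<phi>"
    using \<phi>(1) by (auto simp: K_def fractional_matching_def)
  have max: "fractional_size G \<psi> \<le> fractional_size G \<phi>" if \<psi>: "fractional_matching G \<psi>" for \<psi>
  proof -
    let ?\<psi> = "\<lambda>e. if e \<in> edges G then \<psi> e else 0"
    have "?\<psi> \<in> K"
      using \<psi> by (auto simp: K_def B_def PiE_def Pi_def fractional_matching_def)
    moreover have "fractional_size G ?\<psi> = fractional_size G \<psi>"
      unfolding fractional_size_def by (intro sum.cong) auto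
    ultimately show ?thesis
      using \<phi>(2) by metis
  qed
  have eq: "fractional_matching_number G = fractional_size G \<phi>"
    unfolding fractional_matching_number_def using fm max by (intro cSup_eq_maximum) auto
  show "\<exists>\<phi>. fractional_matching G \<phi> \<and> fractional_size G \<phi> = fractional_matching_number G"
    using fm eq by auto
  show "\<And>\<psi>. fractional_matching G \<psi> \<Longrightarrow> fractional_size G \<psi> \<le> fractional_matching_number G"
    using max eq by simp
qed

end

theory Submission
  imports Defs "HOL-Combinatorics.Orbits"
begin

text \<open>
  Write \<open>a\<close> and \<open>f\<close> for the matching number and the fractional matching number of \<open>G\<close>. The ratio
  bound and the necessary condition \<open>3 a = n + 1\<close>, \<open>2 f = n\<close> for equality both follow from
  \<open>2 f \<le> n\<close> and \<open>2 f \<le> 3 a - 1\<close>. The second inequality is proved by LP duality: for a maximum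
  matching \<open>M\<close> with set \<open>U\<close> of unmatched vertices, weights in \<open>{0, 1, 2}\<close> that sum to at least 2 on
  every edge and have total at most \<open>3 |M| - 1\<close> are read off from the way the edges of \<open>M\<close> are
  attached to \<open>U\<close>. The absence of augmenting paths makes them work; they exist unless the edges of
  \<open>M\<close> and their neighbours in \<open>U\<close> form isolated triangles, so that \<open>G\<close> itself is a triangle.

  If \<open>2 f = n\<close>, Hall's theorem yields a permutation of the vertices that moves every vertex along an
  edge. Its cycles have length at least 2, and a cycle of length \<open>l\<close> contains a matching of size
  \<open>\<lfloor>l / 2\<rfloor>\<close>, so \<open>3 a = n + 1\<close> forces all of them to be triangles except for one of length 2 or 5.
  An edge between two triangles, an edge between a triangle and the 5-cycle, or disjoint edges from
  the two ends of the 2-cycle to two triangles would all enlarge the matching; together with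
  connectedness this leaves only the two configurations of the theorem.
\<close>

section \<open>Hall's marriage theorem\<close>

text \<open>The argument of Halmos and Vaughan, by induction on \<open>I\<close>. A tight subfamily,
  nonempty and proper, is matched separately from the rest. If there is none, a single choice can be
  fixed arbitrarily, since every nonempty proper subfamily has an element to spare.\<close>

lemma halls_theorem:
  fixes A :: "'i \<Rightarrow> 'b set"
  assumes "finite I" and "\<And>i. i \<in> I \<Longrightarrow> finite (A i)"
    and "\<And>J. J \<subseteq> I \<Longrightarrow> card J \<le> card (\<Union>(A ` J))"
  shows "\<exists>f. inj_on f I \<and> (\<forall>i\<in>I. f i \<in> A i)"
  using assms
proof (induction I arbitrary: A rule: finite_psubset_induct)
  case (psubset I)
  have fin: "finite (\<Union>(A ` J))" if "J \<subseteq> I" for J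
    using that psubset.prems(1) finite_subset[OF that psubset.hyps] by auto
  show ?case
  proof (cases "\<exists>J. J \<subset> I \<and> J \<noteq> {} \<and> card (\<Union>(A ` J)) = card J")
    case True
    then obtain J where J: "J \<subset> I" "J \<noteq> {}" "card (\<Union>(A ` J)) = card J"
      by blast
    have "\<exists>f. inj_on f J \<and> (\<forall>i\<in>J. f i \<in> A i)"
      using J psubset.prems by (intro psubset.IH) auto
    then obtain f where f: "inj_on f J" "\<forall>i\<in>J. f i \<in> A i"
      by blast
    \<comment> \<open>Removing the neighbourhood of the tight set \<open>J\<close> preserves Hall's
      condition on \<open>I - J\<close>: apply the condition to \<open>K \<union> J\<close> and
      subtract the equality for \<open>J\<close>.\<close>
    have "\<exists>g. inj_on g (I - J) \<and> (\<forall>i\<in>I - J. g i \<in> A i - \<Union>(A ` J))"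
    proof (intro psubset.IH)
      show "I - J \<subset> I" using J by auto
      show "finite (A i - \<Union>(A ` J))" if "i \<in> I - J" for i
        using that psubset.prems(1) by auto
      fix K assume K: "K \<subseteq> I - J"
      have "finite K" "finite J"
        using K J psubset.hyps by (auto intro: finite_subset)
      then have "card K + card J = card (K \<union> J)"
        using K by (subst card_Un_disjoint) auto
      also have "\<dots> \<le> card (\<Union>(A ` (K \<union> J)))"
        using K J by (intro psubset.prems(2)) auto
      also have "\<Union>(A ` (K \<union> J)) = (\<Union>i\<in>K. A i - \<Union>(A ` J)) \<union> \<Union>(A ` J)"
        by auto
      also have "card \<dots> \<le> card (\<Union>i\<in>K. A i - \<Union>(A ` J)) + card (\<Union>(A ` J))"
        by (rule card_Un_le)
      finally show "card K \<le> card (\<Union>i\<in>K. A i - \<Union>(A ` J))"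
        using J(3) by simp
    qed
    then obtain g where g: "inj_on g (I - J)" "\<forall>i\<in>I - J. g i \<in> A i - \<Union>(A ` J)"
      by blast
    let ?h = "\<lambda>i. if i \<in> J then f i else g i"
    have "inj_on ?h I"
    proof -
      have "f ` J \<subseteq> \<Union>(A ` J)" "g ` (I - J) \<inter> \<Union>(A ` J) = {}"
        using f(2) g(2) by auto
      then have "f ` J \<inter> g ` (I - J) = {}"
        by blast
      then have "inj_on ?h (J \<union> (I - J))"
        by (rule inj_on_disjoint_Un[OF f(1) g(1)])
      moreover have "J \<union> (I - J) = I"
        using J(1) by auto
      ultimately show ?thesis by simp
    qed
    moreover have "\<forall>i\<in>I. ?h i \<in> A i"
      using f g by auto
    ultimately show ?thesis by blast
  next
    case False
    have surplus: "card J < card (\<Union>(A ` J))" if "J \<subset> I" "J \<noteq> {}" for J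
      using False psubset.prems(2)[of J] that by (metis le_neq_implies_less psubset_imp_subset)
    show ?thesis
    proof (cases "I = {}")
      case True
      then show ?thesis by simp
    next
      case False
      then obtain i where i: "i \<in> I" by blast
      have "A i \<noteq> {}"
        using psubset.prems(2)[of "{i}"] i by auto
      then obtain a where a: "a \<in> A i" by blast
      have "\<exists>g. inj_on g (I - {i}) \<and> (\<forall>j\<in>I - {i}. g j \<in> A j - {a})"
      proof (intro psubset.IH)
        show "I - {i} \<subset> I" using i by auto
        show "finite (A j - {a})" if "j \<in> I - {i}" for j
          using that psubset.prems(1) by auto
        fix K assume K: "K \<subseteq> I - {i}"
        have eq: "(\<Union>j\<in>K. A j - {a}) = \<Union>(A ` K) - {a}"
          by auto
        show "card K \<le> card (\<Union>j\<in>K. A j - {a})"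
        proof (cases "K = {}")
          case False
          then have "card K < card (\<Union>(A ` K))"
            using K i by (intro surplus) auto
          moreover have "card (\<Union>(A ` K)) - 1 \<le> card (\<Union>(A ` K) - {a})"
            using card_Diff1_le fin by (metis card_Diff_singleton_if diff_le_self order_refl)
          ultimately show ?thesis
            unfolding eq by linarith
        qed simp
      qed
      then obtain g where g: "inj_on g (I - {i})" "\<forall>j\<in>I - {i}. g j \<in> A j - {a}"
        by blast
      have "inj_on (g(i := a)) I"
      proof (rule inj_onI)
        fix j k assume "j \<in> I" "k \<in> I" "(g(i := a)) j = (g(i := a)) k"
        then show "j = k"
          using g by (auto split: if_splits dest: inj_onD)
      qed
      moreover have "\<forall>j\<in>I. (g(i := a)) j \<in> A j"
        using g a by auto
      ultimately show ?thesis by blast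
    qed
  qed
qed

section \<open>The bound by maximum matchings\<close>

locale finite_graph =
  fixes G :: "'a graph" and V E
  assumes graph: "finite_simple_graph G"
  defines "V \<equiv> verts G" and "E \<equiv> edges G"
begin

lemma finite_V: "finite V"
  using graph by (simp add: finite_simple_graph_def V_def)

lemma finite_E: "finite E"
  using finite_edges[OF graph] by (simp add: E_def)

lemma edge_subset: "e \<in> E \<Longrightarrow> e \<subseteq> V"
  using graph by (simp add: finite_simple_graph_def V_def E_def)

lemma edge_card: "e \<in> E \<Longrightarrow> card e = 2"
  using graph by (simp add: finite_simple_graph_def E_def)

lemma edgeD: "{x, y} \<in> E \<Longrightarrow> x \<noteq> y \<and> x \<in> V \<and> y \<in> V"
  using edge_card[of "{x, y}"] edge_subset[of "{x, y}"] by auto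

lemma edgeE:
  assumes "e \<in> E" "x \<in> e"
  obtains y where "e = {x, y}" "x \<noteq> y"
  using edge_card[OF assms(1)] assms(2) by (auto simp: card_2_iff)

lemma matching_iff: "matching G M \<longleftrightarrow> M \<subseteq> E \<and> pairwise disjnt M"
  by (simp add: matching_def E_def)

lemma finite_matching: "matching G M \<Longrightarrow> finite M"
  by (auto simp: matching_iff intro: finite_subset[OF _ finite_E])

lemma finite_matching_cards: "finite (card ` {M. matching G M})"
  by (rule finite_imageI, rule finite_subset[of _ "Pow E"]) (auto simp: matching_iff finite_E)

lemma card_le_matching_number: "matching G M \<Longrightarrow> card M \<le> matching_number G"
  unfolding matching_number_def by (rule Max_ge[OF finite_matching_cards]) auto

lemma matching_number_attained: "\<exists>M. matching G M \<and> card M = matching_number G"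
proof -
  have "matching G {}" by (simp add: matching_def)
  then have "matching_number G \<in> card ` {M. matching G M}"
    unfolding matching_number_def by (intro Max_in finite_matching_cards) auto
  then show ?thesis by auto
qed

text \<open>Weak LP duality: \<open>w / 2\<close> is a fractional vertex cover.\<close>

lemma fractional_size_le_cover:
  fixes w :: "'a \<Rightarrow> nat"
  assumes cover: "\<And>x y. {x, y} \<in> E \<Longrightarrow> 2 \<le> w x + w y"
    and \<phi>: "fractional_matching G \<phi>"
  shows "2 * fractional_size G \<phi> \<le> real (sum w V)"
proof -
  have nonneg: "0 \<le> \<phi> e" if "e \<in> E" for e
    using \<phi> that by (auto simp: fractional_matching_def E_def)
  have "2 * fractional_size G \<phi> = (\<Sum>e\<in>E. 2 * \<phi> e)"
    by (simp add: fractional_size_def E_def sum_distrib_left)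
  also have "\<dots> \<le> (\<Sum>e\<in>E. \<Sum>v | v \<in> V \<and> v \<in> e. real (w v) * \<phi> e)"
  proof (rule sum_mono)
    fix e assume e: "e \<in> E"
    then obtain x y where xy: "e = {x, y}" "x \<noteq> y"
      using edge_card by (meson card_2_iff)
    have "{v \<in> V. v \<in> e} = {x, y}"
      using edge_subset[OF e] xy by auto
    moreover have "2 * \<phi> e \<le> real (w x + w y) * \<phi> e"
      using cover[of x y] e xy nonneg[OF e] by (intro mult_right_mono) auto
    ultimately show "2 * \<phi> e \<le> (\<Sum>v | v \<in> V \<and> v \<in> e. real (w v) * \<phi> e)"
      using xy by (simp add: algebra_simps)
  qed
  also have "\<dots> = (\<Sum>v\<in>V. \<Sum>e | e \<in> E \<and> v \<in> e. real (w v) * \<phi> e)"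
    by (rule sum.swap_restrict[OF finite_E finite_V])
  also have "\<dots> = (\<Sum>v\<in>V. real (w v) * (\<Sum>e | e \<in> E \<and> v \<in> e. \<phi> e))"
    by (simp add: sum_distrib_left)
  also have "\<dots> \<le> (\<Sum>v\<in>V. real (w v) * 1)"
    using \<phi> by (intro sum_mono mult_left_mono) (auto simp: fractional_matching_def V_def E_def)
  finally show ?thesis by simp
qed

text \<open>Connectedness enters the argument only through this closure principle: it excludes small
  graphs in the bound and yields edges that leave a given cycle in the extremal case.\<close>

lemma connected_closed_eq:
  assumes "graph_connected G" "S \<subseteq> V" "S \<noteq> {}"
    and closed: "\<And>x y. {x, y} \<in> E \<Longrightarrow> x \<in> S \<Longrightarrow> y \<in> S"
  shows "S = V"
proof -
  obtain s where s: "s \<in> S" using assms(3) by blast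
  have "v \<in> S" if v: "v \<in> V" for v
  proof -
    have "(s, v) \<in> {(x, y). {x, y} \<in> E}\<^sup>*"
      using assms(1,2) s v by (auto simp: graph_connected_def reachable_def V_def E_def)
    then show ?thesis
      by (induction rule: rtrancl_induct) (use s closed in auto)
  qed
  with assms(2) show ?thesis by auto
qed

end

section \<open>Exchanges in a maximum matching\<close>

locale max_matching = finite_graph +
  fixes M U
  assumes M: "matching G M"
    and maximum: "\<And>M'. matching G M' \<Longrightarrow> card M' \<le> card M"
  defines "U \<equiv> V - \<Union>M"
begin

lemma M_edge: "e \<in> M \<Longrightarrow> e \<in> E"
  using M by (auto simp: matching_iff)

lemma M_disjoint: "e \<in> M \<Longrightarrow> e' \<in> M \<Longrightarrow> e \<noteq> e' \<Longrightarrow> e \<inter> e' = {}"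
  using M by (auto simp: matching_iff pairwise_def disjnt_def)

lemma finite_M: "finite M"
  using M by (rule finite_matching)

lemma M_unique: "e \<in> M \<Longrightarrow> e' \<in> M \<Longrightarrow> x \<in> e \<Longrightarrow> x \<in> e' \<Longrightarrow> e = e'"
  using M_disjoint by blast

text \<open>Exchanging \<open>F\<close> for \<open>F'\<close> in \<open>M\<close> gives a matching
  again, because \<open>F'\<close> touches only vertices of \<open>F\<close> and unmatched ones; so
  maximality of \<open>M\<close> applies. Each augmenting path excluded below is an
  instance.\<close>

lemma augment_le:
  assumes F: "F \<subseteq> M" and F': "matching G F'" and cover: "\<Union>F' \<subseteq> \<Union>F \<union> U"
  shows "card F' \<le> card F"
proof -
  have disj: "e \<inter> e' = {}" if "e \<in> M - F" "e' \<in> F'" for e e'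
  proof -
    have "e \<inter> \<Union>F = {}"
      using that F M_disjoint by blast
    moreover have "e \<inter> U = {}"
      using that by (auto simp: U_def)
    ultimately show ?thesis
      using that cover by blast
  qed
  have ne: "e \<noteq> {}" if "e \<in> F'" for e
    using that F' edge_card[of e] by (auto simp: matching_iff)
  have "matching G (M - F \<union> F')"
    unfolding matching_iff
  proof
    show "M - F \<union> F' \<subseteq> E"
      using M F' by (auto simp: matching_iff)
    show "pairwise disjnt (M - F \<union> F')"
      unfolding pairwise_def disjnt_def
    proof (intro ballI impI)
      fix e e' assume "e \<in> M - F \<union> F'" "e' \<in> M - F \<union> F'" "e \<noteq> e'"
      then show "e \<inter> e' = {}"
        using disj[of e e'] disj[of e' e] M_disjoint[of e e'] F'
        by (auto simp: matching_iff pairwise_def disjnt_def)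
    qed
  qed
  from maximum[OF this] have "card (M - F \<union> F') \<le> card M" .
  moreover have "card (M - F \<union> F') = card (M - F) + card F'"
  proof (rule card_Un_disjoint)
    show "(M - F) \<inter> F' = {}"
      using disj ne by blast
  qed (use finite_M finite_matching[OF F'] in auto)
  moreover have "card (M - F) = card M - card F" "card F \<le> card M"
    using F finite_M by (auto intro: card_Diff_subset card_mono finite_subset)
  ultimately show ?thesis by linarith
qed

definition nb where "nb x = {u \<in> U. {x, u} \<in> E}"

definition Nb where "Nb e = (\<Union>x\<in>e. nb x)"

lemma U_not_M: "u \<in> U \<Longrightarrow> e \<in> M \<Longrightarrow> u \<notin> e"
  by (auto simp: U_def)

lemma finite_U: "finite U"
  using finite_V by (simp add: U_def)

lemma finite_nb: "finite (nb x)"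
  using finite_U by (simp add: nb_def)

lemma Nb_subset: "Nb e \<subseteq> U"
  by (auto simp: Nb_def nb_def)

lemma finite_Nb: "finite (Nb e)"
  using finite_subset[OF Nb_subset finite_U] .

lemma U_independent: "{u, u'} \<in> E \<Longrightarrow> u \<in> U \<Longrightarrow> u' \<notin> U"
  using augment_le[of "{}" "{{u, u'}}"] by (auto simp: matching_iff)

text \<open>Otherwise \<open>u, x, y, u'\<close> would be an augmenting path with three edges. Hence
  two mates that both have neighbours in \<open>U\<close> have the same single one.\<close>

lemma mates_share_free_nb:
  assumes "{x, y} \<in> M" "u \<in> nb x" "u' \<in> nb y"
  shows "u = u'"
proof (rule ccontr)
  assume "u \<noteq> u'"
  have "x \<noteq> y" "u \<notin> {x, y}" "u' \<notin> {x, y}"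
    using assms edgeD[of x y] M_edge U_not_M by (auto simp: nb_def)
  with \<open>u \<noteq> u'\<close> have "{x, u} \<inter> {y, u'} = {}" "{x, u} \<noteq> {y, u'}"
    by auto
  then have "card {{x, u}, {y, u'}} \<le> card {{x, y}}"
    using assms by (intro augment_le) (auto simp: matching_iff pairwise_def disjnt_def nb_def)
  with \<open>{x, u} \<noteq> {y, u'}\<close> show False by simp
qed

text \<open>Otherwise \<open>u1, x1, y1, y2, x2, u2\<close> would be an augmenting path with five
  edges.\<close>

lemma linked_mates_share_free_nb:
  assumes "{x1, y1} \<in> M" "{x2, y2} \<in> M" "{x1, y1} \<noteq> {x2, y2}" "{y1, y2} \<in> E"
    "u1 \<in> nb x1" "u2 \<in> nb x2"
  shows "u1 = u2"
proof (rule ccontr)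
  assume "u1 \<noteq> u2"
  have d: "x1 \<noteq> y1" "x2 \<noteq> y2" "{x1, y1} \<inter> {x2, y2} = {}"
    using assms edgeD M_edge M_disjoint by blast+
  have u: "u1 \<notin> {x1, y1}" "u1 \<notin> {x2, y2}" "u2 \<notin> {x1, y1}" "u2 \<notin> {x2, y2}"
    using assms U_not_M by (auto simp: nb_def)
  have 3: "card {{x1, u1}, {y1, y2}, {x2, u2}} = 3"
    using d u \<open>u1 \<noteq> u2\<close> by (auto simp: card_insert_if doubleton_eq_iff)
  have "card {{x1, u1}, {y1, y2}, {x2, u2}} \<le> card {{x1, y1}, {x2, y2}}"
    using assms d u \<open>u1 \<noteq> u2\<close>
    by (intro augment_le) (auto simp: matching_iff pairwise_def disjnt_def nb_def)
  then show False
    unfolding 3 using assms(3) by simp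
qed

lemma sum_V: "sum w V = sum w U + (\<Sum>e\<in>M. sum w e)" for w :: "'a \<Rightarrow> nat"
proof -
  have sub: "\<Union>M \<subseteq> V"
    using M_edge edge_subset by blast
  have "sum w V = sum w (V - \<Union>M) + sum w (\<Union>M)"
    by (rule sum.subset_diff[OF sub finite_V])
  also have "sum w (\<Union>M) = (\<Sum>e\<in>M. sum w e)"
    using M_edge edge_card M_disjoint
    by (subst sum.Union_disjoint) (auto simp: card_ge_0_finite)
  finally show ?thesis by (simp add: U_def)
qed

lemma sum_indicator_U:
  assumes "W \<subseteq> U"
  shows "(\<Sum>v\<in>U. if v \<in> W then 1 else 0) = card W"
  using assms finite_U by (simp add: sum.If_cases Int_absorb1)

text \<open>If the bound fails, duality makes every \<open>w\<close> that sums to at least 2 on each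
  edge cost at least \<open>3 * card M\<close>. Two explicit choices of \<open>w\<close> then force
  structure: the first shows that each edge in \<open>T\<close> has a neighbour in \<open>U\<close>
  not shared with the others in \<open>T\<close>, the second that every edge of \<open>M\<close>
  spans a triangle with a vertex of \<open>U\<close>. Connectedness then leaves a single vertex or a
  single triangle, where the bound is indeed false.\<close>

lemma fractional_size_bound:
  assumes conn: "graph_connected G" and card_V: "card V \<ge> 4" and \<phi>: "fractional_matching G \<phi>"
  shows "2 * fractional_size G \<phi> \<le> 3 * real (card M) - 1"
proof (rule ccontr)
  assume large: "\<not> ?thesis"
  have expensive: "3 * card M \<le> sum w V"
    if "\<And>x y. {x, y} \<in> E \<Longrightarrow> 2 \<le> w x + w y" for w :: "'a \<Rightarrow> nat"
  proof (rule ccontr)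
    assume "\<not> 3 * card M \<le> sum w V"
    then have "real (sum w V) \<le> 3 * real (card M) - 1"
      by linarith
    then show False
      using fractional_size_le_cover[of w \<phi>] that \<phi> large by force
  qed
  \<comment> \<open>A matching edge outside \<open>T\<close> has a unique end attached to \<open>U\<close>; that end gets weight 2. For an edge
    in \<open>T\<close> it is cheaper to give weight 1 to its only neighbour in \<open>U\<close>, which saves weight as soon as
    that neighbour is missing or already paid for.\<close>
  define T where "T = {e \<in> M. card (Nb e) \<le> 1}"
  have T: "T \<subseteq> M" "finite T"
    using finite_M by (auto simp: T_def)
  \<comment> \<open>If \<open>e\<close> contributes nothing new, the paid vertices \<open>W\<close>
    number less than \<open>card T\<close>. The weights then total at most
    \<open>card W + 2 * card T + 3 * (card M - card T)\<close>, which is below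
    \<open>3 * card M\<close>. An empty \<open>Nb e\<close> is covered by this as well.\<close>
  have thin_new: "\<not> Nb e \<subseteq> \<Union>(Nb ` (T - {e}))" if e: "e \<in> T" for e
  proof
    assume sub: "Nb e \<subseteq> \<Union>(Nb ` (T - {e}))"
    define W where "W = \<Union>(Nb ` T)"
    define w where "w v = (if v \<in> U then if v \<in> W then 1 else 0
        else if 2 \<le> card (nb v) then 2 else 1 :: nat)" for v
    have "W = \<Union>(Nb ` (T - {e}))"
      using sub e by (auto simp: W_def)
    then have "card W \<le> (\<Sum>e\<in>T - {e}. card (Nb e))"
      using T card_UN_le[of "T - {e}" Nb] by simp
    also have "\<dots> \<le> (\<Sum>e\<in>T - {e}. 1)"
      by (intro sum_mono) (auto simp: T_def)
    finally have W: "card W < card T"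
      using card_Suc_Diff1[OF T(2) e] by simp
    have "sum w U = card W"
      using sum_indicator_U[of W] Nb_subset by (auto simp: w_def W_def intro: sum.cong)
    moreover have "(\<Sum>e\<in>M. sum w e) \<le> (\<Sum>e\<in>M. if e \<in> T then 2 else 3)"
    proof (rule sum_mono)
      fix e assume e: "e \<in> M"
      then obtain x y where xy: "e = {x, y}" "x \<noteq> y"
        using M_edge edge_card by (meson card_2_iff)
      have notU: "x \<notin> U" "y \<notin> U"
        using U_not_M e xy by auto
      have "nb x \<subseteq> Nb e" "nb y \<subseteq> Nb e"
        by (auto simp: Nb_def xy)
      then have le: "card (nb x) \<le> card (Nb e)" "card (nb y) \<le> card (Nb e)"
        using finite_Nb card_mono by blast+
      have "\<not> (2 \<le> card (nb x) \<and> 2 \<le> card (nb y))"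
      proof
        assume *: "2 \<le> card (nb x) \<and> 2 \<le> card (nb y)"
        then obtain u where "u \<in> nb x" by fastforce
        then have "nb y \<subseteq> {u}"
          using mates_share_free_nb e xy by blast
        then have "card (nb y) \<le> card {u}"
          by (rule card_mono[rotated]) simp
        with * show False by simp
      qed
      then show "sum w e \<le> (if e \<in> T then 2 else 3)"
        using xy notU le e by (auto simp: w_def T_def)
    qed
    moreover have "(\<Sum>e\<in>M. if e \<in> T then 2 else 3 :: nat) = 3 * card M - card T" "card T \<le> card M"
    proof -
      show "card T \<le> card M" using T finite_M card_mono by blast
      then show "(\<Sum>e\<in>M. if e \<in> T then 2 else 3 :: nat) = 3 * card M - card T"
        using T finite_M by (simp add: sum.If_cases Int_absorb1 Diff_eq[symmetric] card_Diff_subset)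
    qed
    ultimately have "sum w V < 3 * card M"
      using W by (simp add: sum_V)
    moreover have "2 \<le> w x + w y" if "{x, y} \<in> E" for x y
    proof -
      \<comment> \<open>Edges that avoid \<open>U\<close> get at least 1 + 1, so only edges into
        \<open>U\<close> need care. If \<open>x\<close> has weight 1, then \<open>u\<close> is its
        only neighbour in \<open>U\<close>; its mate has no other one either, so their edge lies in
        \<open>T\<close> and \<open>u\<close> is paid for.\<close>
      have main: "2 \<le> w x + w u" if E: "{x, u} \<in> E" "u \<in> U" for x u
      proof -
        have x: "x \<notin> U" "x \<in> V" "u \<in> nb x"
          using U_independent[of u x] E edgeD by (auto simp: insert_commute nb_def)
        then obtain e where e: "e \<in> M" "x \<in> e"
          by (auto simp: U_def)
        then obtain y where y: "e = {x, y}"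
          using M_edge edgeE by metis
        show ?thesis
        proof (cases "2 \<le> card (nb x)")
          case False
          have "nb x \<subseteq> {u}"
            using False x(3) finite_nb[of x]
            by (metis One_nat_def card_le_Suc0_iff_eq not_less_eq_eq numeral_2_eq_2 singleton_iff subsetI)
          moreover have "nb y \<subseteq> {u}"
            using mates_share_free_nb x(3) e y by blast
          ultimately have "Nb e = {u}"
            using x(3) by (auto simp: Nb_def y)
          then have "u \<in> W"
            using e by (auto simp: W_def T_def)
          then show ?thesis
            using E x(1) by (simp add: w_def)
        qed (use x in \<open>auto simp: w_def\<close>)
      qed
      show ?thesis
      proof (cases "x \<in> U \<or> y \<in> U")
        case True
        then show ?thesis
          using main[of x y] main[of y x] that by (auto simp: insert_commute add.commute)
      qed (auto simp: w_def)
    qed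
    ultimately show False
      using expensive[of w] by force
  qed
  have Nb_nonempty: "Nb e \<noteq> {}" if "e \<in> M" for e
    using thin_new[of e] that by (auto simp: T_def)
  have thin_eq: "e = e'" if "e \<in> M" "e' \<in> M" "Nb e = {u}" "Nb e' = {u}" for e e' u
    using thin_new[of e] that by (force simp: T_def)
  \<comment> \<open>The vertices reached from \<open>U\<close> by an alternating path of two edges,
    the second one in \<open>M\<close>.\<close>
  define Y where "Y = {y. \<exists>x. {x, y} \<in> M \<and> nb x \<noteq> {}}"
  \<comment> \<open>Adjacent vertices of \<open>Y\<close> on different matching edges would extend
    to a path between vertices of \<open>U\<close> through their mates. As it must not be
    augmenting, both matching edges have the same single neighbour \<open>u\<close> in
    \<open>U\<close>, contrary to \<open>thin_eq\<close>.\<close>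
  have Y_edge: "e = e'"
    if yy: "{y, y'} \<in> E" "y \<in> Y" "y' \<in> Y" "y \<in> e" "y' \<in> e'" "e \<in> M" "e' \<in> M" for y y' e e'
  proof (rule ccontr)
    assume ne: "e \<noteq> e'"
    obtain x x' where x: "{x, y} \<in> M" "nb x \<noteq> {}" "{x', y'} \<in> M" "nb x' \<noteq> {}"
      using yy(2,3) by (auto simp: Y_def)
    have e: "e = {x, y}" "e' = {x', y'}"
      using x yy M_unique by blast+
    have *: "u = u'" if "u \<in> nb x" "u' \<in> nb x'" for u u'
      using linked_mates_share_free_nb[of x y x' y' u u'] x e ne yy(1) that by blast
    obtain u where u: "nb x = {u}" "nb x' = {u}"
      using x * by blast
    then have "nb y \<subseteq> {u}" "nb y' \<subseteq> {u}"
      using mates_share_free_nb x by blast+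
    then have "Nb e = {u}" "Nb e' = {u}"
      using u by (auto simp: Nb_def e)
    with thin_eq ne that show False by blast
  qed
  \<comment> \<open>An edge in \<open>A\<close> spans a triangle with a vertex of \<open>U\<close>, which gets weight 1 throughout. Every other
    matching edge can be given weights 2 and 0, because vertices of \<open>Y\<close> on different edges are not
    adjacent.\<close>
  define A where "A = {e \<in> M. \<forall>x\<in>e. nb x \<noteq> {}}"
  have Nb_A: "\<exists>u. Nb e = {u}" if "e \<in> A" for e
  proof -
    obtain x y where xy: "e = {x, y}" "x \<noteq> y"
      using \<open>e \<in> A\<close> edge_card[OF M_edge[of e]] unfolding A_def card_2_iff by blast
    have "nb x \<noteq> {}" "nb y \<noteq> {}" "{x, y} \<in> M"
      using that xy by (auto simp: A_def)
    then obtain u where u: "u \<in> nb x"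
      by blast
    have *: "v = v'" if "v \<in> nb x" "v' \<in> nb y" for v v'
      using mates_share_free_nb[OF \<open>{x, y} \<in> M\<close>] that .
    have "nb y = {u}"
      using *[OF u] \<open>nb y \<noteq> {}\<close> by blast
    moreover from this have "nb x = {u}"
      using *[of _ u] u by blast
    ultimately show ?thesis
      by (auto simp: Nb_def xy)
  qed
  \<comment> \<open>Each edge of \<open>A\<close> puts just one vertex into \<open>W\<close>, so
    \<open>card W\<close> is at most \<open>card A\<close>. The weights defined here total
    \<open>card W + 2 * card M\<close>, which is too cheap unless \<open>A\<close> is all of
    \<open>M\<close>.\<close>
  have "A = M"
  proof (rule ccontr)
    assume "A \<noteq> M"
    then have "card A < card M"
      using finite_M by (intro psubset_card_mono) (auto simp: A_def)
    define W where "W = \<Union>(Nb ` A)"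
    define w where "w v = (if v \<in> U then if v \<in> W then 1 else 0
        else if nb v = {} then 0 else if v \<in> Y then 1 else 2 :: nat)" for v
    have "card W \<le> (\<Sum>e\<in>A. card (Nb e))"
      using finite_M unfolding W_def A_def by (intro card_UN_le) auto
    also have "\<dots> = (\<Sum>e\<in>A. 1)"
      using Nb_A by (intro sum.cong) fastforce+
    finally have "card W < card M"
      using \<open>card A < card M\<close> by simp
    moreover have "sum w U = card W"
      using sum_indicator_U[of W] Nb_subset by (auto simp: w_def W_def intro: sum.cong)
    moreover have "(\<Sum>e\<in>M. sum w e) = (\<Sum>e\<in>M. 2)"
    proof (rule sum.cong)
      fix e assume e: "e \<in> M"
      then obtain x y where xy: "e = {x, y}" "x \<noteq> y"
        using M_edge edge_card by (meson card_2_iff)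
      have notU: "x \<notin> U" "y \<notin> U"
        using U_not_M e xy by auto
      have "{x, y} \<in> M" "{y, x} \<in> M"
        using e xy by (simp_all add: insert_commute)
      have "z = y" if "{z, x} \<in> M" for z
        using M_unique[OF that e, of x] xy by auto
      then have Yx: "x \<in> Y \<longleftrightarrow> nb y \<noteq> {}"
        unfolding Y_def using \<open>{y, x} \<in> M\<close> by blast
      have "z = x" if "{z, y} \<in> M" for z
        using M_unique[OF that e, of y] xy by auto
      then have Yy: "y \<in> Y \<longleftrightarrow> nb x \<noteq> {}"
        unfolding Y_def using \<open>{x, y} \<in> M\<close> by blast
      have "nb x \<noteq> {} \<or> nb y \<noteq> {}"
        using Nb_nonempty[OF e] xy by (auto simp: Nb_def)
      then show "sum w e = 2"
        using xy notU Yx Yy by (auto simp: w_def)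
    qed simp
    ultimately have "sum w V < 3 * card M"
      by (simp add: sum_V)
    moreover have "2 \<le> w x + w y" if E: "{x, y} \<in> E" for x y
    proof -
      have Y_or: "x \<in> Y \<or> nb x \<noteq> {}" if "x \<in> e" "e \<in> M" for x e
      proof -
        obtain y where y: "e = {x, y}"
          using \<open>x \<in> e\<close> \<open>e \<in> M\<close> M_edge edgeE by metis
        then show ?thesis
          using Nb_nonempty[OF that(2)] that(2) by (auto simp: Nb_def Y_def insert_commute)
      qed
      have free: "2 \<le> w x + w u" if E: "{x, u} \<in> E" "u \<in> U" for x u
      proof -
        have x: "x \<notin> U" "x \<in> V" "u \<in> nb x"
          using U_independent[of u x] E edgeD by (auto simp: insert_commute nb_def)
        show ?thesis
        proof (cases "x \<in> Y")
          case True
          then obtain y where y: "{y, x} \<in> M" "nb y \<noteq> {}"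
            by (auto simp: Y_def)
          then have "{y, x} \<in> A" "u \<in> Nb {y, x}"
            using x by (auto simp: A_def Nb_def)
          then have "u \<in> W"
            by (auto simp: W_def)
          then show ?thesis
            using E x by (auto simp: w_def)
        qed (use x in \<open>auto simp: w_def\<close>)
      qed
      \<comment> \<open>Here \<open>x\<close> has weight 0 and lies in \<open>Y\<close>, because its
        mate must be the attached end. Then \<open>y\<close> is not in \<open>Y\<close>: on another
        matching edge this contradicts \<open>Y_edge\<close>, and as the mate of \<open>x\<close> it
        would require \<open>nb x\<close> to be nonempty. So \<open>y\<close> is attached and has
        weight 2.\<close>
      have matched: "2 \<le> w y" if E: "{x, y} \<in> E" "x \<notin> U" "y \<notin> U" "nb x = {}" for x y
      proof -
        obtain e e' where e: "e \<in> M" "x \<in> e" "e' \<in> M" "y \<in> e'"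
          using E(2,3) edgeD[OF E(1)] by (auto simp: U_def)
        have "x \<in> Y"
          using Y_or[of x e] e E by blast
        have "y \<notin> Y"
        proof
          assume "y \<in> Y"
          then have "e' = e"
            using Y_edge[OF E(1) \<open>x \<in> Y\<close>] e by blast
          then have "{x, y} \<in> M"
            using e E edgeD[OF E(1)] edgeE[OF M_edge, of e x] by (metis insertE singletonD)
          moreover obtain z where z: "{z, y} \<in> M" "nb z \<noteq> {}"
            using \<open>y \<in> Y\<close> by (auto simp: Y_def)
          ultimately have "{z, y} = {x, y}"
            using M_unique[of "{z, y}" "{x, y}" y] by blast
          then have "z = x"
            by (auto simp: doubleton_eq_iff)
          with z E show False by simp
        qed
        with Y_or[of y e'] e E show ?thesis
          by (simp add: w_def)
      qed
      show ?thesis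
      proof (cases "x \<in> U \<or> y \<in> U")
        case True
        then show ?thesis
          using free[of x y] free[of y x] E by (auto simp: insert_commute add.commute)
      next
        case False
        show ?thesis
        proof (cases "nb x = {} \<or> nb y = {}")
          case True
          then show ?thesis
            using matched[of x y] matched[of y x] E False by (auto simp: insert_commute)
        qed (use False in \<open>auto simp: w_def\<close>)
      qed
    qed
    ultimately show False
      using expensive[of w] by force
  qed
  have "M \<noteq> {}"
  proof
    assume "M = {}"
    then have U: "U = V" by (simp add: U_def)
    obtain v where "v \<in> V"
      using card_V by (metis all_not_in_conv card.empty not_numeral_le_zero)
    then have "{v} = V"
      using U U_independent edgeD by (intro connected_closed_eq[OF conn]) auto
    then have "card V = 1"
      by (metis is_singletonI is_singleton_altdef)
    with card_V show False by simp
  qed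
  then obtain e where e: "e \<in> M" by blast
  then obtain x y where xy: "e = {x, y}" "x \<noteq> y"
    using M_edge edge_card by (meson card_2_iff)
  obtain u where u: "Nb e = {u}"
    using Nb_A \<open>A = M\<close> e by blast
  have all_Y: "v \<in> Y" if "e \<in> M" "v \<in> e" for v e
  proof -
    obtain y where y: "e = {v, y}"
      using \<open>e \<in> M\<close> \<open>v \<in> e\<close> M_edge edgeE by metis
    have "e \<in> A"
      using \<open>A = M\<close> that by simp
    then have "{y, v} \<in> M" "nb y \<noteq> {}"
      using y by (auto simp: A_def insert_commute)
    then show ?thesis
      by (auto simp: Y_def)
  qed
  have in_Nb: "u' \<in> Nb e'" if "{v, u'} \<in> E" "u' \<in> U" "v \<in> e'" for v u' e'
    using that by (auto simp: Nb_def nb_def)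
  \<comment> \<open>Now all matched vertices lie in \<open>Y\<close>, so \<open>Y_edge\<close>
    excludes edges between different edges of \<open>M\<close>, and \<open>thin_eq\<close> excludes
    a second matching edge at \<open>u\<close>. The triangle is therefore closed under
    adjacency.\<close>
  have "insert u e = V"
  proof (rule connected_closed_eq[OF conn])
    show "insert u e \<subseteq> V"
      using u Nb_subset[of e] e M_edge edge_subset by (auto simp: U_def)
    fix p q assume pq: "{p, q} \<in> E" "p \<in> insert u e"
    have uU: "u \<in> U" using u Nb_subset[of e] by auto
    show "q \<in> insert u e"
    proof (cases "q \<in> U")
      case True
      then have "p \<noteq> u"
        using U_independent[of p q] pq uU by auto
      then show ?thesis
        using in_Nb[of p q e] pq True u by auto
    next
      case False
      then obtain e' where e': "e' \<in> M" "q \<in> e'"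
        using edgeD[OF pq(1)] by (auto simp: U_def)
      have "e' = e"
      proof (cases "p = u")
        case True
        then have "u \<in> Nb e'"
          using in_Nb[of q u e'] pq e' uU by (simp add: insert_commute)
        moreover obtain u' where "Nb e' = {u'}"
          using Nb_A \<open>A = M\<close> e' by blast
        ultimately show ?thesis
          using thin_eq[of e' e u] u e e' by auto
      next
        case False
        then show ?thesis
          using Y_edge[OF pq(1), of e e'] all_Y pq e e' by auto
      qed
      with e' show ?thesis by simp
    qed
  qed simp
  then have "card V \<le> 3"
    using xy by (auto simp: card_insert_if)
  with card_V show False by simp
qed

end

section \<open>Perfect fractional matchings\<close>

context finite_graph
begin

text \<open>A set \<open>J\<close> violating Hall's condition for neighbourhoods would give a
  fractional vertex cover of size below \<open>card V / 2\<close>, against weak duality. The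
  resulting injective choice of neighbours maps the finite set \<open>V\<close> into itself, so it
  is a permutation.\<close>

lemma perfect_fractional_matching_permutation:
  assumes \<phi>: "fractional_matching G \<phi>" and perfect: "2 * fractional_size G \<phi> = real (card V)"
  shows "\<exists>s. s permutes V \<and> (\<forall>v\<in>V. {v, s v} \<in> E)"
proof -
  define N where "N v = {u. {v, u} \<in> E}" for v
  have N_V: "N v \<subseteq> V" for v
    using edgeD by (auto simp: N_def)
  have hall: "card J \<le> card (\<Union>(N ` J))" if J: "J \<subseteq> V" for J
  proof -
    let ?N = "\<Union>(N ` J)"
    \<comment> \<open>Moving weight from \<open>J\<close> to its neighbourhood keeps the constant cover 1 a cover.\<close>
    define w :: "'a \<Rightarrow> nat" where "w v = 1 + of_bool (v \<in> ?N) - of_bool (v \<in> J)" for v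
    have "real (card V) \<le> real (sum w V)"
      unfolding perfect[symmetric] using \<phi>
      by (rule fractional_size_le_cover[rotated]) (auto simp: w_def N_def insert_commute of_bool_def)
    moreover have "sum w V + card J = card V + card ?N"
    proof -
      have count: "(\<Sum>v\<in>V. of_bool (v \<in> S)) = card S" if "S \<subseteq> V" for S
        using that finite_V by (simp add: Int_absorb2 Collect_conj_eq Int_commute)
      have count_N: "(\<Sum>v\<in>V. of_bool (v \<in> ?N)) = card ?N"
        by (rule count) (use N_V in blast)
      have "sum w V + card J = (\<Sum>v\<in>V. w v + of_bool (v \<in> J))"
        using count[OF J] by (simp add: sum.distrib)
      \<comment> \<open>The natural subtraction in \<open>w\<close> never truncates, since at most 1
        is taken from at least 1.\<close>
      also have "\<dots> = (\<Sum>v\<in>V. 1 + of_bool (v \<in> ?N))"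
        by (intro sum.cong) (auto simp: w_def of_bool_def)
      also have "\<dots> = card V + card ?N"
        unfolding sum.distrib count_N by simp
      finally show ?thesis .
    qed
    ultimately show ?thesis by linarith
  qed
  have "finite (N v)" for v
    using N_V finite_V by (rule finite_subset)
  then have "\<exists>f. inj_on f V \<and> (\<forall>v\<in>V. f v \<in> N v)"
    by (intro halls_theorem finite_V hall)
  then obtain f where f: "inj_on f V" "\<forall>v\<in>V. f v \<in> N v"
    by blast
  define s where "s v = (if v \<in> V then f v else v)" for v
  have "inj_on s V" "s ` V \<subseteq> V"
    using f N_V[THEN subsetD] by (auto simp: s_def inj_on_def)
  then have "bij_betw s V V"
    using finite_V by (simp add: bij_betw_def endo_inj_surj)
  then have "s permutes V"
    by (rule bij_imp_permutes) (simp add: s_def)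
  moreover have "\<forall>v\<in>V. {v, s v} \<in> E"
    using f by (auto simp: s_def N_def)
  ultimately show ?thesis by blast
qed

section \<open>Matching numbers of vertex sets and of cycles\<close>

text \<open>The matching number of the subgraph induced on \<open>S\<close>. Phrasing it with
  matchings of \<open>G\<close> lets matchings on disjoint sets be united directly, so
  \<open>nu\<close> is superadditive.\<close>

definition nu where "nu S = Max (card ` {F. matching G F \<and> \<Union>F \<subseteq> S})"

lemma finite_nu: "finite (card ` {F. matching G F \<and> \<Union>F \<subseteq> S})"
  by (rule finite_subset[OF _ finite_matching_cards]) auto

lemma nu_ge: "matching G F \<Longrightarrow> \<Union>F \<subseteq> S \<Longrightarrow> card F \<le> nu S"
  unfolding nu_def by (rule Max_ge[OF finite_nu]) auto

lemma nu_attained: "\<exists>F. matching G F \<and> \<Union>F \<subseteq> S \<and> card F = nu S"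
proof -
  have "matching G {}" by (simp add: matching_def)
  then have "nu S \<in> card ` {F. matching G F \<and> \<Union>F \<subseteq> S}"
    unfolding nu_def by (intro Max_in finite_nu) auto
  then show ?thesis by auto
qed

lemma nu_le_matching_number: "nu S \<le> matching_number G"
  using nu_attained[of S] card_le_matching_number by metis

lemma matching_Un_disjoint:
  assumes "matching G F" "matching G F'" "\<Union>F \<inter> \<Union>F' = {}"
  shows "matching G (F \<union> F')" "card (F \<union> F') = card F + card F'"
proof -
  have ne: "e \<noteq> {}" if "e \<in> F" for e
    using that assms edge_card[of e] by (auto simp: matching_iff)
  show "matching G (F \<union> F')"
    unfolding matching_iff pairwise_def disjnt_def
  proof (intro conjI ballI impI)
    fix e e' assume "e \<in> F \<union> F'" "e' \<in> F \<union> F'" "e \<noteq> e'"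
    moreover have "e \<inter> e' = {}" if "e \<in> F" "e' \<in> F'" for e e'
      using assms(3) that by blast
    ultimately show "e \<inter> e' = {}"
      using assms(1,2) unfolding matching_iff pairwise_def disjnt_def by (metis Int_commute UnE)
  qed (use assms(1,2) in \<open>auto simp: matching_iff\<close>)
  have "F \<inter> F' = {}"
    using assms(3) ne by blast
  then show "card (F \<union> F') = card F + card F'"
    using assms finite_matching by (intro card_Un_disjoint)
qed

lemma nu_Un:
  assumes "S \<inter> T = {}"
  shows "nu S + nu T \<le> nu (S \<union> T)"
proof -
  obtain F F' where F: "matching G F" "\<Union>F \<subseteq> S" "card F = nu S"
    "matching G F'" "\<Union>F' \<subseteq> T" "card F' = nu T"
    using nu_attained by metis
  have disj: "\<Union>F \<inter> \<Union>F' = {}"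
    using F assms by blast
  have "card (F \<union> F') \<le> nu (S \<union> T)"
    using matching_Un_disjoint(1)[OF F(1,4) disj] F by (intro nu_ge) auto
  then show ?thesis
    using matching_Un_disjoint(2)[OF F(1,4) disj] F by simp
qed

lemma nu_Union:
  assumes "finite P" "pairwise disjnt P"
  shows "(\<Sum>S\<in>P. nu S) \<le> nu (\<Union>P)"
  using assms
proof (induction P rule: finite_induct)
  case (insert S P)
  have "S \<inter> \<Union>P = {}"
    using insert by (auto simp: pairwise_insert disjnt_def)
  from nu_Un[OF this] insert show ?case
    by (simp add: pairwise_insert)
qed simp

text \<open>A cycle of length 2 is an edge traversed back and forth.\<close>

definition cycle_on :: "(nat \<Rightarrow> 'a) \<Rightarrow> nat \<Rightarrow> bool" where
  "cycle_on f l \<longleftrightarrow> 2 \<le> l \<and> inj_on f {..<l} \<and> (\<forall>i<l. {f i, f (Suc i mod l)} \<in> E)"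

text \<open>Take every second edge of the cycle. Stopping at \<open>l div 2\<close> avoids the
  wrap-around, so for odd \<open>l\<close> just the last vertex stays unmatched.\<close>

lemma nu_cycle:
  assumes "cycle_on f l"
  shows "l div 2 \<le> nu (f ` {..<l})"
proof -
  let ?e = "\<lambda>i. {f (2 * i), f (Suc (2 * i))}"
  have inj: "f i = f j \<longleftrightarrow> i = j" if "i < l" "j < l" for i j
    using assms that by (auto simp: cycle_on_def inj_on_def)
  have disj: "?e i \<inter> ?e j = {}" if "i < l div 2" "j < l div 2" "i \<noteq> j" for i j
    using that inj by (auto; presburger)
  have "inj_on ?e {..<l div 2}"
    using disj by (intro inj_onI) blast
  then have "l div 2 = card (?e ` {..<l div 2})"
    by (simp add: card_image)
  also have "\<dots> \<le> nu (f ` {..<l})"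
  proof (rule nu_ge)
    have "?e i \<in> E" if "i < l div 2" for i
    proof -
      have "2 * i < l" "Suc (2 * i) mod l = Suc (2 * i)"
        using that by auto
      with assms show ?thesis
        unfolding cycle_on_def by metis
    qed
    then show "matching G (?e ` {..<l div 2})"
      using disj by (auto simp: matching_iff pairwise_def disjnt_def)
    show "\<Union>(?e ` {..<l div 2}) \<subseteq> f ` {..<l}"
      by auto
  qed
  finally show ?thesis .
qed

text \<open>Among at most three indices, any two are cyclically consecutive.\<close>

lemma short_cycle_complete:
  assumes "cycle_on f l" "l \<le> 3" "i < l" "j < l" "i \<noteq> j"
  shows "{f i, f j} \<in> E"
proof -
  have "j = Suc i mod l \<or> i = Suc j mod l"
  proof -
    have "l = 2 \<or> l = 3"
      using assms(1,2) by (auto simp: cycle_on_def)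
    then show ?thesis
      using assms(3-5) by (auto simp: mod_Suc)
  qed
  moreover have "{f i, f (Suc i mod l)} \<in> E" "{f j, f (Suc j mod l)} \<in> E"
    using assms(1,3,4) by (auto simp: cycle_on_def)
  ultimately show ?thesis
    by (metis insert_commute)
qed

text \<open>The iterates of \<open>s\<close> up to the first return to \<open>v\<close> enumerate
  the orbit. The length is at least 2 because an edge \<open>{v, s v}\<close> rules out a fixed
  point.\<close>

lemma orbit_cycle_on:
  assumes s: "s permutes V" and edge: "\<And>v. v \<in> V \<Longrightarrow> {v, s v} \<in> E" and v: "v \<in> V"
  shows "\<exists>f. cycle_on f (card (orbit s v)) \<and> orbit s v = f ` {..<card (orbit s v)}"
proof -
  let ?l = "funpow_dist1 s v v" and ?f = "\<lambda>i. (s ^^ i) v"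
  have self: "v \<in> orbit s v"
    using s finite_V by (intro permutation_self_in_orbit) (auto simp: permutation_permutes)
  have inj: "inj_on ?f {..<?l}"
    using inj_on_funpow_dist1[OF self] by (simp add: lessThan_atLeast0)
  have orb: "orbit s v = ?f ` {..<?l}"
    using orbit_conv_funpow_dist1[OF self] by (simp add: lessThan_atLeast0)
  then have card: "card (orbit s v) = ?l"
    using inj by (simp add: card_image)
  have per: "?f ?l = v"
    by (rule funpow_dist1_prop[OF self])
  have inV: "?f i \<in> V" for i
    by (induction i) (use v permutes_in_image[OF s] in auto)
  have "s v \<noteq> v"
    using edge[OF v] edgeD[of v "s v"] by auto
  then have "funpow_dist s (s v) v \<noteq> 0"
    using per by (metis One_nat_def funpow_0 funpow_Suc_right comp_apply)
  then have "2 \<le> ?l" by simp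
  moreover have "{?f i, ?f (Suc i mod ?l)} \<in> E" if "i < ?l" for i
  proof -
    have "?f (Suc i mod ?l) = ?f (Suc i)"
      by (rule funpow_mod_eq[OF per])
    then show ?thesis
      using edge[OF inV[of i]] by simp
  qed
  ultimately have "cycle_on ?f ?l"
    using inj by (simp add: cycle_on_def)
  then show ?thesis
    unfolding card using orb by blast
qed

lemma permutation_cycles:
  assumes s: "s permutes V" and edge: "\<And>v. v \<in> V \<Longrightarrow> {v, s v} \<in> E"
  obtains P where "\<Union>P = V" "finite P" "pairwise disjnt P"
    "\<And>S. S \<in> P \<Longrightarrow> \<exists>f. cycle_on f (card S) \<and> S = f ` {..<card S}"
proof
  let ?P = "orbit s ` V"
  have perm: "permutation s"
    using s finite_V by (auto simp: permutation_permutes)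
  show "\<Union>?P = V"
    using permutes_orbit_subset[OF s] permutation_self_in_orbit[OF perm] by blast
  show "finite ?P"
    using finite_V by simp
  show "pairwise disjnt ?P"
    unfolding pairwise_def disjnt_def
    using orbit_cyclic_eq3[OF cyclic_on_orbit'[OF perm]] by blast
  show "\<exists>f. cycle_on f (card S) \<and> S = f ` {..<card S}" if "S \<in> ?P" for S
    using that orbit_cycle_on[OF s edge] by blast
qed

section \<open>Copies of fixed graphs\<close>

lemma contains_copyI:
  assumes "inj_on f (verts H)" "f ` verts H \<subseteq> V" "\<And>e. e \<in> edges H \<Longrightarrow> f ` e \<in> E"
  shows "contains_copy G H"
  unfolding contains_copy_def
proof (intro exI conjI)
  show "subgraph (f ` verts H, (\<lambda>e. f ` e) ` edges H) G"
    using assms by (auto simp: subgraph_def V_def E_def)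
  show "graph_iso H (f ` verts H, (\<lambda>e. f ` e) ` edges H)"
    using assms(1) by (auto simp: graph_iso_def bij_betw_def)
qed

lemma cycle_on_contains_copy:
  assumes "cycle_on f l" "f ` {..<l} \<subseteq> V"
  shows "contains_copy G (cycle_graph l)"
proof (rule contains_copyI)
  show "inj_on f (verts (cycle_graph l))" "f ` verts (cycle_graph l) \<subseteq> V"
    using assms by (simp_all add: cycle_graph_def cycle_on_def)
  show "f ` e \<in> E" if "e \<in> edges (cycle_graph l)" for e
    using that assms(1) by (auto simp: cycle_graph_def cycle_on_def)
qed

lemma short_cycles_contain_copy:
  assumes f: "cycle_on f k" "k \<le> 3" "f ` {..<k} \<subseteq> V"
    and g: "cycle_on g l" "l \<le> 3" "g ` {..<l} \<subseteq> V"
    and disj: "f ` {..<k} \<inter> g ` {..<l} = {}"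
  shows "contains_copy G (disjoint_union (complete_graph k) (complete_graph l))"
proof (rule contains_copyI[of "case_sum f g"])
  show "inj_on (case_sum f g) (verts (disjoint_union (complete_graph k) (complete_graph l)))"
  proof -
    have "inj_on f {..<k}" "inj_on g {..<l}"
      using f(1) g(1) by (simp_all add: cycle_on_def)
    moreover have "f i \<noteq> g j" if "i < k" "j < l" for i j
      using disj that by (metis disjoint_iff image_eqI lessThan_iff)
    ultimately show ?thesis
      by (intro inj_onI)
        (auto simp: disjoint_union_def complete_graph_def dest: inj_onD, metis)
  qed
  show "case_sum f g ` verts (disjoint_union (complete_graph k) (complete_graph l)) \<subseteq> V"
    using f g by (auto simp: disjoint_union_def complete_graph_def)
  have pair: "h ` e \<in> E" if h: "cycle_on h m" "m \<le> 3" and e: "e \<subseteq> {..<m}" "card e = 2" for h m e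
  proof -
    obtain i j where "e = {i, j}" "i \<noteq> j"
      using e by (auto simp: card_2_iff)
    then show ?thesis
      using short_cycle_complete[OF h, of i j] e by auto
  qed
  show "case_sum f g ` e \<in> E"
    if "e \<in> edges (disjoint_union (complete_graph k) (complete_graph l))" for e
    using that pair[OF f(1,2)] pair[OF g(1,2)]
    by (auto simp: disjoint_union_def complete_graph_def image_image)
qed

end

lemma graph_iso_complete:
  assumes "finite T" and D: "verts D = T" "edges D = {e. e \<subseteq> T \<and> card e = 2}"
  shows "graph_iso D (complete_graph (card T))"
proof -
  obtain h where h: "bij_betw h T {0..<card T}"
    using ex_bij_betw_finite_nat[OF assms(1)] by blast
  have inj: "inj_on h e" if "e \<subseteq> T" for e
    using h that by (auto simp: bij_betw_def intro: inj_on_subset)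
  have im: "h ` T = {..<card T}"
    using h by (simp add: bij_betw_def lessThan_atLeast0)
  have "{e. e \<subseteq> {..<card T} \<and> card e = 2} = (\<lambda>e. h ` e) ` {e. e \<subseteq> T \<and> card e = 2}"
    unfolding im[symmetric] using inj by (auto simp: subset_image_iff card_image)
  then show ?thesis
    using h D by (auto simp: graph_iso_def complete_graph_def lessThan_atLeast0)
qed

section \<open>The extremal graphs\<close>

text \<open>The equality case with the permutation abstracted away: \<open>P\<close> is the
  partition of the vertices into its cycles, and only the cyclic edges inside each part are
  kept.\<close>

locale cycle_cover = finite_graph +
  fixes P
  assumes conn: "graph_connected G"
    and cover: "\<Union>P = V" and finite_P: "finite P" and disjoint_P: "pairwise disjnt P"
    and cycles: "\<And>S. S \<in> P \<Longrightarrow> \<exists>f. cycle_on f (card S) \<and> S = f ` {..<card S}"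
    and extremal: "3 * matching_number G = card V + 1"
begin

lemma P_disjoint: "S \<in> P \<Longrightarrow> T \<in> P \<Longrightarrow> S \<noteq> T \<Longrightarrow> S \<inter> T = {}"
  using disjoint_P by (auto simp: pairwise_def disjnt_def)

lemma P_subset: "S \<in> P \<Longrightarrow> S \<subseteq> V"
  using cover by auto

lemma P_finite: "S \<in> P \<Longrightarrow> finite S"
  using P_subset finite_V finite_subset by blast

lemma nu_part_ge: "S \<in> P \<Longrightarrow> card S div 2 \<le> nu S \<and> 2 \<le> card S"
  using cycles[of S] nu_cycle by (metis cycle_on_def)

lemma sum_card_P: "(\<Sum>S\<in>P. card S) = card V"
  unfolding cover[symmetric] using P_finite P_disjoint
  by (intro card_Union_disjoint[symmetric] disjoint_P)

text \<open>Each part satisfies \<open>card T \<le> 3 * nu T\<close>, and by superadditivity the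
  total excess is at most 1. It is not 0, since \<open>card V\<close> is 2 modulo 3, so exactly one
  part has excess 1. Together with \<open>nu T \<ge> card T div 2\<close>, excess 0 forces size 3
  and excess 1 forces size 2 or 5.\<close>

lemma exceptional_part:
  obtains S where "S \<in> P" "card S = 2 \<or> card S = 5" "nu S = card S div 2"
    "\<And>T. T \<in> P \<Longrightarrow> T \<noteq> S \<Longrightarrow> card T = 3 \<and> nu T = 1"
proof -
  have le: "card T \<le> 3 * nu T" if "T \<in> P" for T
    using nu_part_ge[OF that] by presburger
  have sum: "(\<Sum>T\<in>P. 3 * nu T) \<le> (\<Sum>T\<in>P. card T) + 1"
    using nu_Union[OF finite_P disjoint_P] nu_le_matching_number[of "\<Union>P"] extremal
    by (simp add: sum_card_P flip: sum_distrib_left)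
  have "\<exists>S\<in>P. card S \<noteq> 3 * nu S"
  proof (rule ccontr)
    assume "\<not> ?thesis"
    then have "card V = 3 * (\<Sum>T\<in>P. nu T)"
      unfolding sum_card_P[symmetric] sum_distrib_left by (intro sum.cong) auto
    with extremal show False by presburger
  qed
  then obtain S where S: "S \<in> P" "card S \<noteq> 3 * nu S" by blast
  have rest: "(\<Sum>T\<in>P - {S}. card T) \<le> (\<Sum>T\<in>P - {S}. 3 * nu T)"
    using le by (intro sum_mono) auto
  have split: "sum g P = g S + sum g (P - {S})" for g :: "'a set \<Rightarrow> nat"
    by (rule sum.remove[OF finite_P S(1)])
  have S_eq: "3 * nu S = card S + 1"
    using sum rest le[OF S(1)] S(2) unfolding split[of card] split[of "\<lambda>T. 3 * nu T"] by linarith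
  then have rest_eq: "(\<Sum>T\<in>P - {S}. 3 * nu T) = (\<Sum>T\<in>P - {S}. card T)"
    using sum rest unfolding split[of card] split[of "\<lambda>T. 3 * nu T"] by linarith
  have T: "card T = 3 \<and> nu T = 1" if "T \<in> P" "T \<noteq> S" for T
  proof -
    have "card T = 3 * nu T"
    proof (rule ccontr)
      assume "card T \<noteq> 3 * nu T"
      then have "(\<Sum>T\<in>P - {S}. card T) < (\<Sum>T\<in>P - {S}. 3 * nu T)"
        using that le finite_P by (intro sum_strict_mono_ex1) (auto intro!: bexI[of _ T] le_neq_trans)
      with rest_eq show False by simp
    qed
    then show ?thesis
      using nu_part_ge[OF that(1)] by presburger
  qed
  have "(card S = 2 \<or> card S = 5) \<and> nu S = card S div 2"
    using nu_part_ge[OF S(1)] S_eq by presburger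
  with S(1) T that show thesis by blast
qed

text \<open>By \<open>exceptional_part\<close> the values of \<open>nu\<close> on the parts already
  add up to the matching number. A better matching on the union of some parts, completed by
  matchings of the others, would exceed it. So any local improvement below is a
  contradiction.\<close>

lemma nu_Union_parts_le:
  assumes Q: "Q \<subseteq> P"
  shows "nu (\<Union>Q) \<le> (\<Sum>S\<in>Q. nu S)"
proof -
  have fin: "finite Q" "finite (P - Q)"
    using Q finite_P by (auto intro: finite_subset)
  have "\<Union>Q \<inter> \<Union>(P - Q) = {}"
    using Q P_disjoint by blast
  then have "nu (\<Union>Q) + nu (\<Union>(P - Q)) \<le> nu (\<Union>Q \<union> \<Union>(P - Q))"
    by (rule nu_Un)
  moreover have "(\<Sum>S\<in>P - Q. nu S) \<le> nu (\<Union>(P - Q))"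
    using disjoint_P by (intro nu_Union fin) (auto simp: pairwise_def)
  moreover have "nu (\<Union>Q \<union> \<Union>(P - Q)) \<le> matching_number G"
    by (rule nu_le_matching_number)
  moreover have "matching_number G \<le> (\<Sum>S\<in>P. nu S)"
  proof -
    obtain S where S: "S \<in> P" "card S = 2 \<or> card S = 5" "nu S = card S div 2"
      "\<And>T. T \<in> P \<Longrightarrow> T \<noteq> S \<Longrightarrow> card T = 3 \<and> nu T = 1"
      by (rule exceptional_part) blast
    have "card V + 1 = 3 * nu S + (\<Sum>T\<in>P - {S}. 3 * nu T)"
      unfolding sum_card_P[symmetric] sum.remove[OF finite_P S(1)]
      using S by auto
    also have "\<dots> = 3 * (\<Sum>S\<in>P. nu S)"
      unfolding sum.remove[OF finite_P S(1), of nu] by (simp add: sum_distrib_left)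
    finally show ?thesis
      using extremal by simp
  qed
  moreover have "(\<Sum>S\<in>P. nu S) = (\<Sum>S\<in>Q. nu S) + (\<Sum>S\<in>P - Q. nu S)"
    using sum.subset_diff[OF Q finite_P, of nu] by simp
  ultimately show ?thesis by linarith
qed

lemma triangle_complete:
  assumes "T \<in> P" "card T \<le> 3" "x \<in> T" "y \<in> T" "x \<noteq> y"
  shows "{x, y} \<in> E"
proof -
  obtain f where "cycle_on f (card T)" "T = f ` {..<card T}"
    using cycles[OF assms(1)] by blast
  then show ?thesis
    using short_cycle_complete[of f "card T"] assms by (metis imageE lessThan_iff)
qed

lemma triangle_minus:
  assumes "T \<in> P" "card T = 3" "t \<in> T"
  shows "T - {t} \<in> E"
proof -
  have "card (T - {t}) = 2"
    using assms P_finite by simp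
  then obtain x y where "T - {t} = {x, y}" "x \<noteq> y"
    by (auto simp: card_2_iff)
  then show ?thesis
    using triangle_complete[OF assms(1), of x y] assms(2) by auto
qed

section \<open>Forbidden edges between the cycles\<close>

text \<open>Such an edge and the two opposite triangle sides would be three disjoint edges on two
  parts with \<open>nu\<close> equal to 1.\<close>

lemma no_edge_between_triangles:
  assumes T: "T \<in> P" "card T = 3" "nu T = 1" and T': "T' \<in> P" "card T' = 3" "nu T' = 1"
    and "T \<noteq> T'" "t \<in> T" "t' \<in> T'"
  shows "{t, t'} \<notin> E"
proof
  assume E: "{t, t'} \<in> E"
  let ?F = "{{t, t'}, T - {t}, T' - {t'}}"
  have disj: "T \<inter> T' = {}"
    using assms P_disjoint by blast
  have E': "T - {t} \<in> E" "T' - {t'} \<in> E"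
    using assms triangle_minus by auto
  have "T - {t} \<noteq> {}" 
    using edge_card[OF E'(1)] by (metis card.empty zero_neq_numeral)
  then have "card ?F = 3"
    using disj assms(8,9) by (auto simp: card_insert_if)
  moreover have "card ?F \<le> nu (\<Union>{T, T'})"
    using E E' disj assms(8,9)
    by (intro nu_ge) (auto simp: matching_iff pairwise_insert disjnt_def)
  moreover have "nu (\<Union>{T, T'}) \<le> (\<Sum>S\<in>{T, T'}. nu S)"
    using assms by (intro nu_Union_parts_le) auto
  ultimately show False
    using assms by simp
qed

text \<open>The edge \<open>{s, t}\<close>, two edges of the path left when \<open>s\<close> is
  removed from the 5-cycle, and the side of \<open>T\<close> opposite \<open>t\<close> would match
  all eight vertices with four edges, where only 2 + 1 are possible.\<close>

lemma no_edge_between_pentagon_and_triangle: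
  assumes S: "S \<in> P" "card S = 5" "nu S = 2" and T: "T \<in> P" "card T = 3" "nu T = 1"
    and "S \<noteq> T" "s \<in> S" "t \<in> T"
  shows "{s, t} \<notin> E"
proof
  assume E: "{s, t} \<in> E"
  have disj: "S \<inter> T = {}"
    using assms P_disjoint by blast
  obtain f where f: "cycle_on f 5" "S = f ` {..<5}"
    using cycles[OF S(1)] S(2) by auto
  then obtain i where i: "i < 5" "s = f i"
    using assms by auto
  \<comment> \<open>The 5-cycle rotated so that \<open>s\<close> gets index 0; the other four
    vertices are then paired as 1, 2 and 3, 4.\<close>
  define g where "g k = f ((i + k) mod 5)" for k
  have g_eq: "g j = g k \<longleftrightarrow> j = k" if "j < 5" "k < 5" for j k
  proof -
    have "g j = g k \<longleftrightarrow> (i + j) mod 5 = (i + k) mod 5"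
      using f(1) by (auto simp: g_def cycle_on_def inj_on_def)
    also have "\<dots> \<longleftrightarrow> j = k"
    proof
      assume eq: "(i + j) mod 5 = (i + k) mod 5"
      show "j = k"
      proof (cases "j \<le> k")
        case True
        then have "5 dvd k - j"
          using eq mod_eq_dvd_iff_nat[of "i + j" "i + k" 5] by simp
        then show ?thesis
          using that True dvd_imp_le[of 5 "k - j"] by (cases "j = k") auto
      next
        case False
        then have "5 dvd j - k"
          using eq mod_eq_dvd_iff_nat[of "i + k" "i + j" 5] by simp
        then show ?thesis
          using that False dvd_imp_le[of 5 "j - k"] by (cases "j = k") auto
      qed
    qed simp
    finally show ?thesis .
  qed
  have gS: "g k \<in> S" for k
    using f(2) by (auto simp: g_def)
  have g_edge: "{g k, g (Suc k)} \<in> E" for k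
  proof -
    have "{f ((i + k) mod 5), f (Suc ((i + k) mod 5) mod 5)} \<in> E"
      using f(1) by (auto simp: cycle_on_def)
    then show ?thesis
      by (simp add: g_def mod_Suc_eq)
  qed
  have s: "s = g 0"
    using i by (simp add: g_def)
  let ?F = "{{g 0, t}, {g 1, g 2}, {g 3, g 4}, T - {t}}"
  have E': "{g 1, g 2} \<in> E" "{g 3, g 4} \<in> E" "T - {t} \<in> E" "{g 0, t} \<in> E"
    using assms triangle_minus g_edge[of 1] g_edge[of 3] E s
    by (auto simp: numeral_2_eq_2 eval_nat_numeral)
  have notT: "g k \<notin> T" for k
    using gS disj by blast
  have "card ?F = 4"
  proof -
    have "{g 0, t} \<notin> {{g 1, g 2}, {g 3, g 4}, T - {t}}"
      using notT assms(9) by (auto simp: doubleton_eq_iff)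
    moreover have "{g 1, g 2} \<notin> {{g 3, g 4}, T - {t}}"
      using notT[of 1] g_eq by (auto simp: doubleton_eq_iff)
    moreover have "{g 3, g 4} \<noteq> T - {t}"
      using notT[of 3] by auto
    ultimately show ?thesis by simp
  qed
  moreover have "card ?F \<le> nu (\<Union>{S, T})"
  proof (rule nu_ge)
    have "t \<noteq> g k" for k
      using notT assms(9) by metis
    then show "matching G ?F"
      using E' notT g_eq by (auto simp: matching_iff pairwise_insert disjnt_def)
    show "\<Union>?F \<subseteq> \<Union>{S, T}"
      using gS assms(9) by auto
  qed
  moreover have "nu (\<Union>{S, T}) \<le> (\<Sum>S\<in>{S, T}. nu S)"
    using assms by (intro nu_Union_parts_le) auto
  ultimately show False
    using assms by simp
qed

text \<open>The two edges into the triangles and the opposite triangle sides would match all eight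
  vertices with four edges, where only 1 + 1 + 1 are possible.\<close>

lemma edge_ends_not_to_different_triangles:
  assumes S: "{x, y} \<in> P" "x \<noteq> y" "nu {x, y} = 1"
    and T: "T \<in> P" "card T = 3" "nu T = 1" and T': "T' \<in> P" "card T' = 3" "nu T' = 1"
    and "T \<noteq> T'" "t \<in> T" "t' \<in> T'" "{x, t} \<in> E"
  shows "{y, t'} \<notin> E"
proof
  assume E: "{y, t'} \<in> E"
  let ?F = "{{x, t}, {y, t'}, T - {t}, T' - {t'}}"
  have S': "{x, y} \<noteq> T" "{x, y} \<noteq> T'"
    using assms by auto
  then have disj: "T \<inter> T' = {}" "x \<notin> T" "y \<notin> T" "x \<notin> T'" "y \<notin> T'"
    using assms P_disjoint[of T T'] P_disjoint[of "{x, y}" T] P_disjoint[of "{x, y}" T'] by auto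
  have t: "t \<notin> T'" "t' \<notin> T" "x \<noteq> t" "x \<noteq> t'" "y \<noteq> t" "y \<noteq> t'" "t \<noteq> t'"
    using disj assms by auto
  have E': "T - {t} \<in> E" "T' - {t'} \<in> E"
    using assms triangle_minus by auto
  have ne: "T - {t} \<noteq> {}"
    using edge_card[OF E'(1)] by (metis card.empty zero_neq_numeral)
  have "T - {t} \<noteq> T' - {t'}"
    using ne disj(1) by blast
  moreover have "{x, t} \<noteq> {y, t'}" "{x, t} \<noteq> T - {t}" "{x, t} \<noteq> T' - {t'}"
    "{y, t'} \<noteq> T - {t}" "{y, t'} \<noteq> T' - {t'}"
    using t \<open>x \<noteq> y\<close> disj by (auto simp: doubleton_eq_iff)
  ultimately have "card ?F = 4"
    by simp
  moreover have "card ?F \<le> nu (\<Union>{{x, y}, T, T'})"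
    using E E' disj t assms
    by (intro nu_ge) (auto simp: matching_iff pairwise_insert disjnt_def)
  moreover have "nu (\<Union>{{x, y}, T, T'}) \<le> (\<Sum>S\<in>{{x, y}, T, T'}. nu S)"
    using assms by (intro nu_Union_parts_le) auto
  ultimately show False
    using assms S' by simp
qed

text \<open>An exceptional 5-cycle cannot be left by an edge, so it is the whole graph. An
  exceptional edge \<open>S\<close> with one triangle gives the other graph on five vertices. With
  more triangles, only one end of \<open>S\<close> can be joined to them, and deleting that end
  isolates the other end and separates the triangles.\<close>

lemma extremal_structure:
  assumes n: "5 \<le> card V"
  shows "(card V = 5 \<and> (contains_copy G (cycle_graph 5) \<or>
            contains_copy G (disjoint_union (complete_graph 2) (complete_graph 3)))) \<or>
    (\<exists>v\<in>V. \<exists>C\<in>graph_components (delete_vertex G v).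
       card (verts C) = 1 \<and>
       (\<forall>D\<in>graph_components (delete_vertex G v) - {C}. graph_iso D (complete_graph 3)))"
proof -
  obtain S where S: "S \<in> P" "card S = 2 \<or> card S = 5" "nu S = card S div 2"
    and triangles: "\<And>T. T \<in> P \<Longrightarrow> T \<noteq> S \<Longrightarrow> card T = 3 \<and> nu T = 1"
    by (rule exceptional_part) blast
  obtain f where f: "cycle_on f (card S)" "S = f ` {..<card S}"
    using cycles[OF S(1)] by blast
  have part: "\<exists>T\<in>P. v \<in> T" if "v \<in> V" for v
    using that cover by auto
  have leave: "\<exists>x y T. x \<in> A \<and> {x, y} \<in> E \<and> T \<in> P \<and> T \<noteq> A \<and> y \<in> T" if A: "A \<in> P" "A \<noteq> V" for A
  proof (rule ccontr)
    assume none: "\<not> ?thesis"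
    have "y \<in> A" if xy: "{x, y} \<in> E" "x \<in> A" for x y
      using none xy part[of y] edgeD[OF xy(1)] by metis
    moreover have "A \<noteq> {}"
      using nu_part_ge[OF A(1)] by auto
    ultimately have "A = V"
      using P_subset[OF A(1)] by (intro connected_closed_eq[OF conn]) auto
    with A show False by simp
  qed
  from S(2) show ?thesis
  proof
    assume 5: "card S = 5"
    have "S = V"
    proof (rule ccontr)
      assume "S \<noteq> V"
      then obtain x y T where "x \<in> S" "{x, y} \<in> E" "T \<in> P" "T \<noteq> S" "y \<in> T"
        using leave S(1) by blast
      then show False
        using no_edge_between_pentagon_and_triangle[of S T x y] S 5 triangles[of T] by auto
    qed
    then have "contains_copy G (cycle_graph 5)"
      using cycle_on_contains_copy[OF f(1)] f(2) 5 by auto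
    with \<open>S = V\<close> 5 show ?thesis by simp
  next
    assume 2: "card S = 2"
    then have nuS: "nu S = 1"
      using S(3) by simp
    have "S \<noteq> V"
      using 2 n by auto
    then obtain T where T: "T \<in> P" "T \<noteq> S"
      using leave S(1) by blast
    show ?thesis
    proof (cases "card V = 5")
      case True
      obtain g where g: "cycle_on g (card T)" "T = g ` {..<card T}"
        using cycles[OF T(1)] by blast
      have "contains_copy G (disjoint_union (complete_graph 2) (complete_graph 3))"
        using short_cycles_contain_copy[OF f(1) _ _ g(1)] f(2) g(2) 2 triangles[OF T]
          P_subset[OF S(1)] P_subset[OF T(1)] P_disjoint[OF S(1) T(1)] T(2) by auto
      with True show ?thesis by simp
    next
      case False
      have more: "\<exists>T'\<in>P. T' \<noteq> S \<and> T' \<noteq> T" for T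
      proof (rule ccontr)
        assume "\<not> ?thesis"
        then have P: "P \<subseteq> {S, T}" by blast
        have "card V \<le> 5"
        proof (cases "T \<in> P \<and> T \<noteq> S")
          case True
          then have "V = S \<union> T"
            using P cover S(1) by auto
          then show ?thesis
            using 2 triangles[of T] card_Un_le[of S T] True by auto
        next
          case False
          then have "V = S"
            using P cover S(1) by auto
          then show ?thesis
            using 2 by simp
        qed
        with False n show False by simp
      qed
      \<comment> \<open>Some edge leaves the triangle \<open>T\<close>, and it cannot end in another
        triangle.\<close>
      have to_S: "\<exists>x\<in>S. \<exists>t\<in>T. {x, t} \<in> E" if T: "T \<in> P" "T \<noteq> S" for T
      proof -
        have "T \<noteq> V"
          using triangles[OF T] n by auto
        then obtain x y T' where *: "x \<in> T" "{x, y} \<in> E" "T' \<in> P" "T' \<noteq> T" "y \<in> T'"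
          using leave T(1) by blast
        have "T' = S"
        proof (rule ccontr)
          assume "T' \<noteq> S"
          then show False
            using no_edge_between_triangles[of T T' x y] * T triangles[of T] triangles[of T'] by auto
        qed
        moreover have "{y, x} \<in> E"
          using *(2) by (simp add: insert_commute)
        ultimately show ?thesis
          using * by blast
      qed
      obtain a b where ab: "S = {a, b}" "a \<noteq> b"
        using 2 by (auto simp: card_2_iff)
      have cross: False
        if "{x, y} = S" "x \<noteq> y" "T \<in> P" "T \<noteq> S" "T' \<in> P" "T' \<noteq> S" "T \<noteq> T'"
          "t \<in> T" "t' \<in> T'" "{x, t} \<in> E" "{y, t'} \<in> E" for x y T T' t t'
        using edge_ends_not_to_different_triangles[of x y T T' t t'] that S(1) nuS
          triangles[of T] triangles[of T'] by auto
      \<comment> \<open>If both ends of \<open>S\<close> had neighbours in triangles,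
        \<open>cross\<close> would make it the same triangle \<open>T\<close>. Another triangle
        \<open>R\<close> is attached to one of the ends, and that edge together with the edge from
        the other end to \<open>T\<close> contradicts \<open>cross\<close>.\<close>
      have "\<exists>x y. S = {x, y} \<and> x \<noteq> y \<and> (\<forall>T\<in>P - {S}. \<forall>t\<in>T. {y, t} \<notin> E)"
      proof (rule ccontr)
        assume none: "\<not> ?thesis"
        have "S = {b, a}" "b \<noteq> a"
          using ab by auto
        with none ab obtain T t T' t' where
          T: "T \<in> P - {S}" "t \<in> T" "{b, t} \<in> E" and T': "T' \<in> P - {S}" "t' \<in> T'" "{a, t'} \<in> E"
          by metis
        have "T' = T"
          using cross[of a b T' T t' t] T T' ab by auto
        obtain R where R: "R \<in> P" "R \<noteq> S" "R \<noteq> T"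
          using more by blast
        obtain x r where "x \<in> S" "r \<in> R" "{x, r} \<in> E"
          using to_S R by blast
        then show False
          using cross[of a b R T r t] cross[of a b T R t' r] T T' \<open>T' = T\<close> R ab by auto
      qed
      then obtain x y where xy: "S = {x, y}" "x \<noteq> y"
        and y: "\<And>T t. T \<in> P \<Longrightarrow> T \<noteq> S \<Longrightarrow> t \<in> T \<Longrightarrow> {y, t} \<notin> E"
        by blast
      let ?H = "delete_vertex G x"
      have x_y_V: "x \<in> V" "y \<in> V"
        using P_subset[OF S(1)] xy by auto
      \<comment> \<open>Serves both kinds of components of \<open>G - x\<close>, the singleton of
        \<open>y\<close> and the triangles. Completeness at \<open>u\<close> reaches all of
        \<open>A\<close> in one step, and closedness keeps walks inside \<open>A\<close>.\<close>
      have comp: "{v. reachable ?H u v} = A"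
        if A: "u \<in> A" "A \<subseteq> V - {x}"
          and complete: "\<And>v. v \<in> A \<Longrightarrow> v \<noteq> u \<Longrightarrow> {u, v} \<in> E"
          and closed: "\<And>p q. {p, q} \<in> E \<Longrightarrow> p \<in> A \<Longrightarrow> q \<noteq> x \<Longrightarrow> q \<in> A" for u A
      proof
        let ?R = "{(p, q). {p, q} \<in> edges ?H}"
        have R: "(p, q) \<in> ?R \<longleftrightarrow> {p, q} \<in> E \<and> p \<noteq> x \<and> q \<noteq> x" for p q
          by (auto simp: delete_vertex_def E_def)
        show "{v. reachable ?H u v} \<subseteq> A"
        proof
          fix v assume "v \<in> {v. reachable ?H u v}"
          then have "(u, v) \<in> ?R\<^sup>*"
            by (simp add: reachable_def)
          then show "v \<in> A"
          proof (induction rule: rtrancl_induct)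
            case (step p q)
            then show ?case using closed[of p q] R by blast
          qed (rule A(1))
        qed
        show "A \<subseteq> {v. reachable ?H u v}"
        proof
          fix v assume v: "v \<in> A"
          have "(u, v) \<in> ?R\<^sup>*"
          proof (cases "v = u")
            case False
            then have "(u, v) \<in> ?R"
              unfolding R using complete v A by auto
            then show ?thesis by blast
          qed simp
          then show "v \<in> {v. reachable ?H u v}"
            using A v by (auto simp: reachable_def delete_vertex_def V_def)
        qed
      qed
      have comp_y: "{v. reachable ?H y v} = {y}"
      proof (rule comp)
        fix p q assume pq: "{p, q} \<in> E" "p \<in> {y}" "q \<noteq> x"
        obtain T where "T \<in> P" "q \<in> T"
          using part edgeD pq by blast
        then show "q \<in> {y}"
          using y[of T q] pq xy by (cases "T = S") auto
      qed (use xy x_y_V in auto)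
      have comp_T: "{v. reachable ?H u v} = T" if T: "T \<in> P" "T \<noteq> S" "u \<in> T" for u T
      proof (rule comp)
        show "u \<in> T" by (rule T)
        have "x \<notin> T"
          using P_disjoint[OF T(1) S(1) T(2)] xy by auto
        then show "T \<subseteq> V - {x}"
          using P_subset[OF T(1)] by auto
        show "{u, v} \<in> E" if "v \<in> T" "v \<noteq> u" for v
          using triangle_complete[OF T(1)] triangles[OF T(1,2)] T(3) that by auto
        fix p q assume pq: "{p, q} \<in> E" "p \<in> T" "q \<noteq> x"
        obtain T' where T': "T' \<in> P" "q \<in> T'"
          using part edgeD[OF pq(1)] by blast
        have "T' \<noteq> S"
          using y[OF T(1,2) pq(2)] pq T' xy by (auto simp: insert_commute)
        then have "T' = T"
          using no_edge_between_triangles[of T T' p q] T T' pq triangles[of T] triangles[of T'] by auto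
        with T' show "q \<in> T" by simp
      qed
      let ?C = "induced_subgraph ?H {v. reachable ?H y v}"
      have "?C \<in> graph_components ?H"
        using xy x_y_V by (auto simp: graph_components_def delete_vertex_def V_def)
      moreover have "verts ?C = {y}"
        unfolding comp_y using xy x_y_V by (auto simp: induced_subgraph_def delete_vertex_def V_def)
      moreover have "graph_iso D (complete_graph 3)" if D: "D \<in> graph_components ?H - {?C}" for D
      proof -
        obtain u where u: "u \<in> V" "u \<noteq> x" "D = induced_subgraph ?H {v. reachable ?H u v}"
          using D by (auto simp: graph_components_def delete_vertex_def V_def)
        have "u \<noteq> y"
          using u D by auto
        obtain T where T: "T \<in> P" "u \<in> T"
          using part u by blast
        then have TS: "T \<noteq> S"
          using u \<open>u \<noteq> y\<close> xy by auto
        have x: "x \<notin> T"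
          using P_disjoint[OF T(1) S(1) TS] xy by auto
        have D_eq: "D = induced_subgraph ?H T"
          using u(3) comp_T[OF T(1) TS T(2)] by simp
        have "{p, q} \<in> E" if "p \<in> T" "q \<in> T" "p \<noteq> q" for p q
          using triangle_complete[OF T(1)] triangles[OF T(1) TS] that by auto
        then have "e \<in> E" if "e \<subseteq> T" "card e = 2" for e
          using that by (auto simp: card_2_iff)
        then have "edges D = {e. e \<subseteq> T \<and> card e = 2}"
          using x edge_card by (auto simp: D_eq induced_subgraph_def delete_vertex_def E_def)
        moreover have "verts D = T"
          using x P_subset[OF T(1)] by (auto simp: D_eq induced_subgraph_def delete_vertex_def V_def)
        ultimately show ?thesis
          using graph_iso_complete[OF P_finite[OF T(1)]] triangles[OF T(1) TS] by metis
      qed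
      ultimately show ?thesis
        using x_y_V by (metis is_singletonI is_singleton_altdef)
    qed
  qed
qed

end

section \<open>The ratio bound and the case of equality\<close>

theorem theorem8:
  fixes G :: "'a graph" and n :: nat
  assumes "finite_simple_graph G"
    and "graph_connected G"
    and "card (verts G) = n"
    and "n \<ge> 5"
  shows "fractional_matching_number G / real (matching_number G) \<le> 3 * real n / (2 * real n + 2) \<and>
    (fractional_matching_number G / real (matching_number G) = 3 * real n / (2 * real n + 2) \<longrightarrow>
      (n = 5 \<and> (contains_copy G (cycle_graph 5) \<or>
                contains_copy G (disjoint_union (complete_graph 2) (complete_graph 3)))) \<or>
      (\<exists>v\<in>verts G. \<exists>C\<in>graph_components (delete_vertex G v).
         card (verts C) = 1 \<and>
         (\<forall>D\<in>graph_components (delete_vertex G v) - {C}. graph_iso D (complete_graph 3))))"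
proof -
  interpret finite_graph G "verts G" "edges G"
    by unfold_locales (use assms in auto)
  obtain \<phi> where \<phi>: "fractional_matching G \<phi>" "fractional_size G \<phi> = fractional_matching_number G"
    using fractional_matching_number_is_max(1)[OF assms(1)] by blast
  obtain M where max: "matching G M" "card M = matching_number G"
    using matching_number_attained by blast
  interpret max_matching G "verts G" "edges G" M "verts G - \<Union>M"
    by unfold_locales (use max card_le_matching_number in auto)
  let ?f = "fractional_matching_number G" and ?a = "real (matching_number G)"
  have f_a: "2 * ?f \<le> 3 * ?a - 1"
    using fractional_size_bound[of \<phi>] assms \<phi> max(2) by simp
  have f_n: "2 * ?f \<le> real n"
    using fractional_size_le_cover[of "\<lambda>_. 1" \<phi>] assms(3) \<phi> by simp
  have "0 \<le> ?f"
    unfolding \<phi>(2)[symmetric] fractional_size_def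
    using \<phi>(1) by (intro sum_nonneg) (auto simp: fractional_matching_def)
  \<comment> \<open>Positivity of the matching number, needed to clear denominators, comes from
    \<open>0 \<le> 2 * ?f \<le> 3 * ?a - 1\<close>.\<close>
  with f_a have a: "0 < ?a" by linarith
  have iff: "?f / ?a \<le> 3 * real n / (2 * real n + 2) \<longleftrightarrow> 2 * ?f * (real n + 1) \<le> 3 * ?a * real n"
    "?f / ?a = 3 * real n / (2 * real n + 2) \<longleftrightarrow> 2 * ?f * (real n + 1) = 3 * ?a * real n"
    using a by (simp_all add: divide_simps) (auto simp: algebra_simps)
  \<comment> \<open>Above \<open>n + 1\<close> the bound \<open>f_n\<close> gives strict inequality,
    and below it \<open>f_a\<close> does. Equality is possible only in the middle case, where it
    means \<open>2 * ?f = n\<close>.\<close>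
  consider "n + 1 < 3 * matching_number G" | "3 * matching_number G = n + 1" | "3 * matching_number G < n + 1"
    by linarith
  then show ?thesis
  proof cases
    case 1
    have "2 * ?f * (real n + 1) \<le> real n * (real n + 1)"
      using f_n by (intro mult_right_mono) auto
    also have "\<dots> < real n * (3 * ?a)"
      using 1 assms(4) by (intro mult_strict_left_mono) linarith+
    finally show ?thesis
      unfolding iff by (simp add: algebra_simps)
  next
    case 2
    then have a_eq: "3 * ?a = real n + 1" by linarith
    have "2 * ?f * (real n + 1) \<le> real n * (real n + 1)"
      using f_n by (intro mult_right_mono) auto
    moreover have "2 * ?f = real n" if "2 * ?f * (real n + 1) = 3 * ?a * real n"
      using that unfolding a_eq by (simp add: mult.commute[of "real n"])
    moreover have "(n = 5 \<and> (contains_copy G (cycle_graph 5) \<or>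
                contains_copy G (disjoint_union (complete_graph 2) (complete_graph 3)))) \<or>
      (\<exists>v\<in>verts G. \<exists>C\<in>graph_components (delete_vertex G v).
         card (verts C) = 1 \<and>
         (\<forall>D\<in>graph_components (delete_vertex G v) - {C}. graph_iso D (complete_graph 3)))"
      if perfect: "2 * ?f = real n"
    proof -
      obtain s where "s permutes verts G" "\<forall>v\<in>verts G. {v, s v} \<in> edges G"
        using perfect_fractional_matching_permutation[OF \<phi>(1)] perfect \<phi>(2) assms(3) by auto
      then obtain P where P: "\<Union>P = verts G" "finite P" "pairwise disjnt P"
        "\<And>S. S \<in> P \<Longrightarrow> \<exists>f. cycle_on f (card S) \<and> S = f ` {..<card S}"
        using permutation_cycles by metis
      interpret cycle_cover G "verts G" "edges G" P
        by unfold_locales (use P assms(2,3) 2 in auto)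
      show ?thesis
        using extremal_structure assms(3,4) by simp
    qed
    ultimately show ?thesis
      unfolding iff a_eq by (simp add: mult.commute[of "real n"])
  next
    case 3
    have "2 * ?f * (real n + 1) \<le> (3 * ?a - 1) * (real n + 1)"
      using f_a by (intro mult_right_mono) auto
    also have "\<dots> < 3 * ?a * real n"
      using 3 by (simp add: algebra_simps)
    finally show ?thesis
      unfolding iff by simp
  qed
qed

end
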